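(* Let $h$ be an absolutely monotone potential with $h^{(4)}>0$ (on $(-1,1)$), and let $-1\le\alpha\le\beta\le\gamma<1$ be such that there exists an $\{\alpha,\beta,\gamma\}$-code $B$ that is a spherical $3$-design on $\mathbb{S}^{n-1}$. Suppose $$\alpha\beta+\beta\gamma+\gamma\alpha\ \ge\ -\frac{3}{n+2},\qquad \alpha+\beta+\gamma\le0.$$ Let $T=(\alpha,\beta)$ or $T=(\beta,\gamma)$. Then for every $T$-avoiding code $C\subset\mathbb{S}^{n-1}$ with $|C|=|B|$, $$E_h(C)\ \ge\ \mathcal{E}_h(n,|B|;T)=|B|\left(m_\alpha h(\alpha)+m_\beta h(\beta)+m_\gamma h(\gamma)\right),$$ where $(m_\alpha,m_\beta,m_\gamma)$ is the distance distribution of the (distance-invariant) code $B$. If equality $E_h(C)=\mathcal{E}_h(n,|B|;T)$ holds, then $C$ is a spherical $3$-design with $I(C)=\{\alpha,\beta,\gamma\}$ and distance distribution $(m_\alpha,m_\beta,m_\gamma)$.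
   Context: A spherical code is a finite set $C\subset\mathbb{S}^{n-1}$; $I(C)=\{x\cdot y: x,y\in C,\ x\ne y\}$. An $\{\alpha,\beta,\gamma\}$-code is a spherical code with three (distinct) inner products, $I(B)=\{\alpha,\beta,\gamma\}$. For $T\subset[-1,1)$, $C$ is $T$-avoiding if $I(C)\cap T=\varnothing$. A spherical $\tau$-design is a spherical code $C$ such that the average over $C$ of every polynomial in $n$ variables of total degree at most $\tau$ equals its average over $\mathbb{S}^{n-1}$ with respect to normalized surface measure. A potential is a function $h:[-1,1)\to(-\infty,+\infty)$, continuous on $[-1,1)$; it is absolutely monotone if $h^{(j)}\ge0$ for all $j\ge1$ (on $(-1,1)$). The $h$-energy is $E_h(C)=\sum_{x\neq y\in C}h(x\cdot y)$ (sum over ordered pairs). $\mathcal{E}_h(n,N;T)$ is the minimum of $E_h(C)$ over all $T$-avoiding spherical codes $C\subset\mathbb{S}^{n-1}$ with $|C|=N$. A code $C$ is distance invariant if for each $t\in I(C)$ the number $A_t=|\{y\in C: x\cdot y=t\}|$ does not depend on $x\in C$; its distance distribution is the tuple $(A_t)$ listed in increasing order of $t\in I(C)$; for $B$ write $m_\alpha=A_\alpha$, $m_\beta=A_\beta$, $m_\gamma=A_\gamma$. (A spherical $3$-design with three inner products is distance invariant.) *)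

theory Defs
  imports "HOL-Analysis.Analysis"
begin

definition spherical_code :: "(real^'n) set \<Rightarrow> bool" where
  "spherical_code C \<longleftrightarrow> finite C \<and> C \<subseteq> sphere 0 1"

definition inner_products :: "(real^'n) set \<Rightarrow> real set" where
  "inner_products C = {x \<bullet> y | x y. x \<in> C \<and> y \<in> C \<and> x \<noteq> y}"

definition three_code :: "real \<Rightarrow> real \<Rightarrow> real \<Rightarrow> (real^'n) set \<Rightarrow> bool" where
  "three_code \<alpha> \<beta> \<gamma> B \<longleftrightarrow>
     spherical_code B \<and> distinct [\<alpha>, \<beta>, \<gamma>] \<and> inner_products B = {\<alpha>, \<beta>, \<gamma>}"

definition avoiding :: "real set \<Rightarrow> (real^'n) set \<Rightarrow> bool" where
  "avoiding T C \<longleftrightarrow> inner_products C \<inter> T = {}"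

text \<open>Polynomials in the coordinates of total degree at most \<open>d\<close>. The exponent vectors
  \<open>a\<close> range over a finite set, because the index type is finite.\<close>

definition polynomials_upto :: "nat \<Rightarrow> (real^'n \<Rightarrow> real) set" where
  "polynomials_upto d =
     {p. \<exists>c. p = (\<lambda>x. \<Sum>a\<in>{a :: 'n \<Rightarrow> nat. (\<Sum>i\<in>UNIV. a i) \<le> d}.
                        c a * (\<Prod>i\<in>UNIV. (x $ i) ^ a i))}"

text \<open>Normalized surface measure on the unit sphere, as the cone measure: a Borel set \<open>A\<close> on the
  sphere gets the fraction of the volume of the unit ball lying in the cone over \<open>A\<close>. Here
  \<open>sgn x = x /\<^sub>R norm x\<close> is the radial projection (the origin is a null set).\<close>

definition sphere_measure :: "(real^'n) measure" where
  "sphere_measure = distr (uniform_measure lborel (cball 0 1)) borel sgn"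

definition spherical_design :: "nat \<Rightarrow> (real^'n) set \<Rightarrow> bool" where
  "spherical_design \<tau> C \<longleftrightarrow> spherical_code C \<and>
     (\<forall>p \<in> polynomials_upto \<tau>. (\<Sum>x\<in>C. p x) / real (card C) = (\<integral>x. p x \<partial>sphere_measure))"

text \<open>Potentials are total functions here; only their values on \<open>{-1..<1}\<close> matter.\<close>

definition potential :: "(real \<Rightarrow> real) \<Rightarrow> bool" where
  "potential h \<longleftrightarrow> continuous_on {-1..<1} h"

definition absolutely_monotone :: "(real \<Rightarrow> real) \<Rightarrow> bool" where
  "absolutely_monotone h \<longleftrightarrow>
     (\<forall>j. \<forall>t\<in>{-1<..<1}. (deriv ^^ j) h field_differentiable at t) \<and>
     (\<forall>j\<ge>1. \<forall>t\<in>{-1<..<1}. (deriv ^^ j) h t \<ge> 0)"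

definition energy :: "(real \<Rightarrow> real) \<Rightarrow> (real^'n) set \<Rightarrow> real" where
  "energy h C = (\<Sum>x\<in>C. \<Sum>y\<in>C - {x}. h (x \<bullet> y))"

definition avoiding_codes :: "nat \<Rightarrow> real set \<Rightarrow> (real^'n) set set" where
  "avoiding_codes N T = {C. spherical_code C \<and> avoiding T C \<and> card C = N}"

text \<open>The type argument supplies the dimension \<open>n = CARD('n)\<close>. The value is meaningful
  only when the minimum is attained.\<close>

definition min_energy :: "'n::finite itself \<Rightarrow> (real \<Rightarrow> real) \<Rightarrow> nat \<Rightarrow> real set \<Rightarrow> real" where
  "min_energy _ h N T = (LEAST e. e \<in> energy h ` (avoiding_codes N T :: (real^'n) set set))"

definition distance_invariant :: "(real^'n) set \<Rightarrow> bool" where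
  "distance_invariant C \<longleftrightarrow>
     (\<forall>t\<in>inner_products C. \<exists>m. \<forall>x\<in>C. card {y\<in>C. x \<bullet> y = t} = m)"

text \<open>The number \<open>A\<^sub>t\<close> and the distance distribution are meaningful only for nonempty distance
  invariant codes.\<close>

definition distance_mult :: "(real^'n) set \<Rightarrow> real \<Rightarrow> nat" where
  "distance_mult C t = (THE m. \<forall>x\<in>C. card {y\<in>C. x \<bullet> y = t} = m)"

definition distance_distribution :: "(real^'n) set \<Rightarrow> nat list" where
  "distance_distribution C = map (distance_mult C) (sorted_list_of_set (inner_products C))"

end

theory Submission imports Defs begin

text \<open>
  Linear programming with a cubic. Let \<open>f\<close> interpolate \<open>h\<close> at \<open>\<alpha>, \<beta>, \<gamma>\<close> with leading coefficient
  \<open>c\<close>. Then \<open>h t - f t = (g t - c) (t - \<alpha>) (t - \<beta>) (t - \<gamma>)\<close>, where \<open>g t\<close> is the divided difference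
  of \<open>h\<close> at \<open>\<alpha>, \<beta>, \<gamma>, t\<close>, which is positive and strictly increasing; so \<open>f < h\<close> off the nodes and
  off \<open>T\<close> once \<open>c\<close> is the limit of \<open>g\<close> from the right at \<open>\<gamma>\<close> or at \<open>\<alpha>\<close> (this is Hermite interpolation
  at a double node, without any derivative at the possible endpoint \<open>\<alpha> = -1\<close>). The two inequalities
  on \<open>\<alpha>, \<beta>, \<gamma>\<close> make the Gegenbauer coefficients of \<open>f\<close> of degrees 1 to 3 positive. Each of the
  corresponding kernels, summed over a code, is a squared norm of a sum of harmonic tensors, and
  these sums vanish exactly for the \<open>3\<close>-designs. Finally, the moments up to order two determine how often
  each of three inner products occurs.
\<close>

subsection \<open>Derivatives and interpolation\<close>

lemma iterated_Rolle:
  fixes F :: "nat \<Rightarrow> real \<Rightarrow> real" and z :: "nat \<Rightarrow> real"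
  assumes "\<And>i. i < n \<Longrightarrow> z i < z (Suc i)" and "\<And>i. i \<le> n \<Longrightarrow> F 0 (z i) = 0"
    and "continuous_on {z 0..z n} (F 0)"
    and "\<And>j t. z 0 < t \<Longrightarrow> t < z n \<Longrightarrow> (F j has_real_derivative F (Suc j) t) (at t)"
  shows "\<exists>\<xi>. F n \<xi> = 0 \<and> z 0 \<le> \<xi> \<and> \<xi> \<le> z n \<and> (n > 0 \<longrightarrow> z 0 < \<xi> \<and> \<xi> < z n)"
  using assms
proof (induction n arbitrary: F z)
  case 0
  then show ?case by auto
next
  case (Suc n)
  have mono: "z i \<le> z j" if "i \<le> j" "j \<le> Suc n" for i j
    using that
  proof (induction j rule: dec_induct)
    case (step k)
    then show ?case using Suc.prems(1)[of k] by force
  qed simp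
  have "\<exists>w. z i < w \<and> w < z (Suc i) \<and> F 1 w = 0" if i: "i \<le> n" for i
  proof -
    have sub: "z 0 \<le> z i" "z (Suc i) \<le> z (Suc n)" using mono i by auto
    have "continuous_on {z i..z (Suc i)} (F 0)"
      using Suc.prems(3) by (rule continuous_on_subset) (use sub in auto)
    then have "\<exists>w. z i < w \<and> w < z (Suc i) \<and> (\<lambda>v. F 1 w * v) = (\<lambda>v. 0)"
      using Suc.prems i sub
      by (intro Rolle_deriv[of "z i" "z (Suc i)" "F 0" "\<lambda>w v. F 1 w * v"])
        (auto simp: has_field_derivative_def)
    then obtain w where "z i < w" "w < z (Suc i)" "(\<lambda>v. F 1 w * v) = (\<lambda>v. 0)" by blast
    then show ?thesis by (metis mult.right_neutral)
  qed
  then obtain w where w: "\<And>i. i \<le> n \<Longrightarrow> z i < w i \<and> w i < z (Suc i) \<and> F 1 (w i) = 0"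
    by metis
  have w0: "z 0 < w 0" and wn: "w n < z (Suc n)" using w by auto
  have "\<exists>\<xi>. F (Suc n) \<xi> = 0 \<and> w 0 \<le> \<xi> \<and> \<xi> \<le> w n \<and> (n > 0 \<longrightarrow> w 0 < \<xi> \<and> \<xi> < w n)"
  proof (rule Suc.IH[of w "\<lambda>j. F (Suc j)"])
    show "w i < w (Suc i)" if "i < n" for i
      using w[of i] w[of "Suc i"] that by force
    show "F (Suc 0) (w i) = 0" if "i \<le> n" for i
      using w that by auto
    show "continuous_on {w 0..w n} (F (Suc 0))"
      using w0 wn Suc.prems(4)
      by (intro continuous_at_imp_continuous_on ballI DERIV_isCont[OF Suc.prems(4)]) auto
    show "(F (Suc j) has_real_derivative F (Suc (Suc j)) t) (at t)"
      if "w 0 < t" "t < w n" for j t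
      using that w0 wn Suc.prems(4) by auto
  qed
  then show ?case using w0 wn by fastforce
qed

lemma higher_deriv_eq_interpolant_coeff:
  fixes h :: "real \<Rightarrow> real"
  assumes cont: "continuous_on {a..<b} h"
    and diff: "\<And>j t. a < t \<Longrightarrow> t < b \<Longrightarrow> (deriv ^^ j) h field_differentiable at t"
    and X: "X \<subseteq> {a..<b}" "card X = Suc n" and "n > 0"
    and p: "degree p \<le> n" "\<And>x. x \<in> X \<Longrightarrow> h x = poly p x"
  shows "\<exists>\<xi>\<in>{a<..<b}. (deriv ^^ n) h \<xi> = fact n * coeff p n"
proof -
  have fin: "finite X" using X(2) by (metis card.infinite nat.distinct(1))
  define l where "l = sorted_list_of_set X"
  have l: "sorted_wrt (<) l" "set l = X" "length l = Suc n"
    using fin X by (auto simp: l_def)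
  have nth: "l ! i \<in> X" if "i \<le> n" for i using l that nth_mem by fastforce
  define F where "F j t = (deriv ^^ j) h t - poly ((pderiv ^^ j) p) t" for j t
  have D: "(F j has_real_derivative F (Suc j) t) (at t)" if "a < t" "t < b" for j t
    unfolding F_def using diff[OF that, of j]
    by (auto intro!: derivative_eq_intros poly_DERIV simp: field_differentiable_derivI)
  have bounds: "a \<le> l ! 0" "l ! n < b" using X nth by force+
  have "\<exists>\<xi>. F n \<xi> = 0 \<and> l ! 0 \<le> \<xi> \<and> \<xi> \<le> l ! n \<and> (n > 0 \<longrightarrow> l ! 0 < \<xi> \<and> \<xi> < l ! n)"
  proof (rule iterated_Rolle)
    show "l ! i < l ! Suc i" if "i < n" for i
      using l that by (auto simp: sorted_wrt_iff_nth_less)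
    show "F 0 (l ! i) = 0" if "i \<le> n" for i using p(2) nth that by (simp add: F_def)
    show "continuous_on {l ! 0..l ! n} (F 0)"
      unfolding F_def using bounds
      by (auto intro!: continuous_intros continuous_on_subset[OF cont])
  qed (use D bounds in auto)
  then obtain \<xi> where \<xi>: "F n \<xi> = 0" "a < \<xi>" "\<xi> < b" using bounds \<open>n > 0\<close> by force
  have "(pderiv ^^ n) p = [:fact n * coeff p n:]"
  proof (rule poly_eqI)
    fix k show "coeff ((pderiv ^^ n) p) k = coeff [:fact n * coeff p n:] k"
      using p(1) by (cases k)
        (simp_all add: coeff_higher_pderiv pochhammer_fact coeff_eq_0)
  qed
  with \<xi> show ?thesis by (force simp: F_def)
qed

lemma absolutely_monotone_pos:
  assumes h: "absolutely_monotone h" and "\<forall>t\<in>{-1<..<1}. (deriv ^^ n) h t > 0"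
    and "1 \<le> j" "j \<le> n" "t \<in> {-1<..<1}"
  shows "(deriv ^^ j) h t > 0"
  using \<open>j \<le> n\<close> \<open>t \<in> _\<close> \<open>1 \<le> j\<close>
proof (induction j arbitrary: t rule: inc_induct)
  case base
  then show ?case using assms by auto
next
  case (step j)
  define s where "s = (t - 1) / 2"
  have s: "-1 < s" "s < t" "t < 1" using step.prems by (auto simp: s_def)
  have "(deriv ^^ j) h s < (deriv ^^ j) h t"
  proof (rule DERIV_pos_imp_increasing[OF s(2)])
    fix x assume x: "s \<le> x" "x \<le> t"
    have "(deriv ^^ j) h field_differentiable at x"
      using h x s by (auto simp: absolutely_monotone_def)
    moreover have "(deriv ^^ Suc j) h x > 0" using step.IH[of x] step.prems x s by auto
    ultimately show "\<exists>y. ((deriv ^^ j) h has_real_derivative y) (at x) \<and> 0 < y"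
      by (auto dest!: field_differentiable_derivI)
  qed
  moreover have "(deriv ^^ j) h s \<ge> 0"
    using h s step.prems by (auto simp: absolutely_monotone_def)
  ultimately show ?case by linarith
qed

lemma interpolant_coeff_pos:
  assumes "potential h" "absolutely_monotone h" "\<forall>t\<in>{-1<..<1}. (deriv ^^ 4) h t > 0"
    and "X \<subseteq> {-1..<1}" "card X = Suc n" "0 < n" "n \<le> 4"
    and "degree p \<le> n" "\<And>x. x \<in> X \<Longrightarrow> h x = poly p x"
  shows "coeff p n > 0"
proof -
  have "\<exists>\<xi>\<in>{-1<..<1}. (deriv ^^ n) h \<xi> = fact n * coeff p n"
    using assms by (intro higher_deriv_eq_interpolant_coeff)
      (auto simp: potential_def absolutely_monotone_def)
  then obtain \<xi> where "\<xi> \<in> {-1<..<1}" "(deriv ^^ n) h \<xi> = fact n * coeff p n" by blast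
  with absolutely_monotone_pos[OF assms(2,3), of n \<xi>] assms(6,7)
  show ?thesis by (simp add: zero_less_mult_iff)
qed

lemma cubic_minorant:
  fixes h :: "real \<Rightarrow> real"
  assumes h: "potential h" "absolutely_monotone h" "\<forall>t\<in>{-1<..<1}. (deriv ^^ 4) h t > 0"
    and order: "-1 \<le> \<alpha>" "\<alpha> < \<beta>" "\<beta> < \<gamma>" "\<gamma> < 1"
    and T: "T = {\<alpha><..<\<beta>} \<or> T = {\<beta><..<\<gamma>}"
  obtains d\<^sub>1 d\<^sub>2 d\<^sub>3 :: real and f :: "real \<Rightarrow> real"
  where "d\<^sub>1 > 0" "d\<^sub>2 > 0" "d\<^sub>3 > 0"
    and "\<And>t. f t = h \<alpha> + d\<^sub>1 * (t - \<alpha>) + d\<^sub>2 * (t - \<alpha>) * (t - \<beta>) + d\<^sub>3 * (t - \<alpha>) * (t - \<beta>) * (t - \<gamma>)"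
    and "\<And>t. t \<in> {\<alpha>, \<beta>, \<gamma>} \<Longrightarrow> f t = h t"
    and "\<And>t. -1 \<le> t \<Longrightarrow> t < 1 \<Longrightarrow> t \<notin> T \<Longrightarrow> t \<notin> {\<alpha>, \<beta>, \<gamma>} \<Longrightarrow> f t < h t"
proof -
  define d1 where "d1 = (h \<beta> - h \<alpha>) / (\<beta> - \<alpha>)"
  define d2 where "d2 = ((h \<gamma> - h \<alpha>) / (\<gamma> - \<alpha>) - d1) / (\<gamma> - \<beta>)"
  define L where "L = [:h \<alpha>:] + smult d1 [:-\<alpha>, 1:] + smult d2 ([:-\<alpha>, 1:] * [:-\<beta>, 1:])"
  define W where "W = [:-\<alpha>, 1:] * [:-\<beta>, 1:] * [:-\<gamma>, 1:]"
  define g where "g t = (h t - poly L t) / poly W t" for t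
  define V where "V = {t. -1 \<le> t \<and> t < 1 \<and> t \<notin> {\<alpha>, \<beta>, \<gamma>}}"
  note pos = interpolant_coeff_pos[OF h]
  have d1: "d1 * (\<beta> - \<alpha>) = h \<beta> - h \<alpha>" using order by (simp add: d1_def)
  then have L\<beta>: "poly L \<beta> = h \<beta>" by (simp add: L_def algebra_simps)
  have L\<gamma>: "poly L \<gamma> = h \<gamma>"
  proof -
    have "d2 * (\<gamma> - \<beta>) * (\<gamma> - \<alpha>) = h \<gamma> - h \<alpha> - d1 * (\<gamma> - \<alpha>)"
    proof -
      have "d2 * (\<gamma> - \<beta>) = (h \<gamma> - h \<alpha>) / (\<gamma> - \<alpha>) - d1"
        using order by (simp add: d2_def)
      then show ?thesis using order
        by (simp add: left_diff_distrib[of "(h \<gamma> - h \<alpha>) / (\<gamma> - \<alpha>)" d1])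
    qed
    then show ?thesis by (simp add: L_def algebra_simps)
  qed
  have L: "poly L t = h t" if "t \<in> {\<alpha>, \<beta>, \<gamma>}" for t
    proof -
    have "poly L \<alpha> = h \<alpha>" by (simp add: L_def algebra_simps)
    then show ?thesis using that L\<beta> L\<gamma> by blast
  qed
  have W: "poly W t = (t - \<alpha>) * (t - \<beta>) * (t - \<gamma>)" for t by (simp add: W_def algebra_simps)
  have W0: "poly W t = 0" if "t \<in> {\<alpha>, \<beta>, \<gamma>}" for t using that W by auto
  have g: "h t = poly L t + g t * poly W t" if "t \<in> V" for t
    using that by (simp add: g_def W V_def)
  have degL: "degree L \<le> 2"
    unfolding L_def by (intro degree_add_le degree_smult_le[THEN order_trans]
        degree_mult_le[THEN order_trans]) auto
  have degW: "degree W \<le> 3"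
    unfolding W_def by (intro degree_mult_le[THEN order_trans]) auto
  have d1_pos: "d1 > 0"
  proof -
    have "coeff [:h \<alpha> - d1 * \<alpha>, d1:] 1 > 0"
      by (rule pos[of "{\<alpha>, \<beta>}"]) (use order d1 in \<open>auto simp: algebra_simps\<close>)
    then show ?thesis by simp
  qed
  have d2_pos: "d2 > 0"
  proof -
    have "coeff L 2 > 0"
      by (rule pos[of "{\<alpha>, \<beta>, \<gamma>}"]) (use order degL L in auto)
    then show ?thesis by (simp add: L_def eval_nat_numeral)
  qed
  have g_pos: "g t > 0" if t: "t \<in> V" for t
  proof -
    have "coeff (L + smult (g t) W) 3 > 0"
    proof (rule pos[of "insert t {\<alpha>, \<beta>, \<gamma>}"])
      show "degree (L + smult (g t) W) \<le> 3"
        using degL degW by (intro degree_add_le degree_smult_le[THEN order_trans]) auto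
      show "h x = poly (L + smult (g t) W) x" if "x \<in> insert t {\<alpha>, \<beta>, \<gamma>}" for x
        using that L W0 g[OF t] by auto
    qed (use order t in \<open>auto simp: V_def\<close>)
    then show ?thesis by (simp add: L_def W_def eval_nat_numeral)
  qed
  have quartic: "\<exists>\<kappa>>0. g t = g s + \<kappa> * (t - s) \<and>
      (\<forall>x\<in>{\<alpha>, \<beta>, \<gamma>, s, t}. h x = poly (L + smult (g s) W + smult \<kappa> (W * [:-s, 1:])) x)"
    if s: "s \<in> V" and t: "t \<in> V" and "s \<noteq> t" for s t
  proof -
    define \<kappa> where "\<kappa> = (g t - g s) / (t - s)"
    define q where "q = L + smult (g s) W + smult \<kappa> (W * [:-s, 1:])"
    have \<kappa>: "g t = g s + \<kappa> * (t - s)" using \<open>s \<noteq> t\<close> by (simp add: \<kappa>_def)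
    have ht: "h t = poly q t"
      using g[OF t] unfolding q_def \<kappa> by (simp add: algebra_simps)
    have interp: "\<forall>x\<in>{\<alpha>, \<beta>, \<gamma>, s, t}. h x = poly q x"
      using L W0 g[OF s] ht by (auto simp: q_def)
    have "coeff q 4 > 0"
    proof (rule pos[of "{\<alpha>, \<beta>, \<gamma>, s, t}"])
      show "degree q \<le> 4"
        unfolding q_def using degL degW
        by (intro degree_add_le degree_smult_le[THEN order_trans] degree_mult_le[THEN order_trans])
          auto
    qed (use order s t \<open>s \<noteq> t\<close> interp in \<open>auto simp: V_def\<close>)
    then have "\<kappa> > 0" by (simp add: q_def L_def W_def eval_nat_numeral)
    with \<kappa> interp show ?thesis unfolding q_def by blast
  qed
  have g_mono: "g s < g t" if "s \<in> V" "t \<in> V" "s < t" for s t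
    using quartic[of s t] that by force
  \<comment> \<open>Keeps the infimum of \<open>g\<close> on the right of \<open>\<alpha>\<close> positive even if \<open>\<alpha> = -1\<close>.\<close>
  have g_lower: "g s * ((\<gamma> - s) / (\<gamma> - \<alpha>)) \<le> g t" if *: "\<alpha> < t" "t < s" "s < \<beta>" for s t
  proof -
    have sV: "s \<in> V" and tV: "t \<in> V" using * order by (auto simp: V_def)
    obtain \<kappa> where \<kappa>: "\<kappa> > 0" "g t = g s + \<kappa> * (t - s)"
      and interp: "\<forall>x\<in>{\<alpha>, \<beta>, \<gamma>, s, t}. h x = poly (L + smult (g s) W + smult \<kappa> (W * [:-s, 1:])) x"
      using quartic[OF sV tV] * by auto
    define r where "r = L + smult (g s) W + smult (\<kappa> * (t - \<gamma>)) ([:-\<alpha>, 1:] * [:-\<beta>, 1:] * [:-s, 1:])"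
    have "coeff r 3 > 0"
    proof (rule pos[of "{\<alpha>, t, s, \<beta>}"])
      show "degree r \<le> 3"
        unfolding r_def using degL degW
        by (intro degree_add_le degree_smult_le[THEN order_trans] degree_mult_le[THEN order_trans])
          auto
      have "poly (L + smult (g s) W + smult \<kappa> (W * [:-s, 1:])) x
          = poly r x + \<kappa> * ((x - \<alpha>) * (x - t) * (x - s) * (x - \<beta>))" for x
        by (simp add: r_def W algebra_simps)
      then show "h x = poly r x" if "x \<in> {\<alpha>, t, s, \<beta>}" for x
        using interp that by auto
    qed (use order * in auto)
    then have "\<kappa> * (\<gamma> - t) < g s"
      by (simp add: r_def L_def W_def eval_nat_numeral algebra_simps)
    then have "\<kappa> \<le> g s / (\<gamma> - t)" using * order by (simp add: pos_le_divide_eq)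
    then have "\<kappa> * (s - t) \<le> g s / (\<gamma> - t) * (s - t)"
      using * by (intro mult_right_mono) auto
    then have "\<kappa> * (s - t) \<le> g s * ((s - t) / (\<gamma> - t))" by simp
    also have "\<dots> \<le> g s * ((s - \<alpha>) / (\<gamma> - \<alpha>))"
    proof (rule mult_left_mono)
      show "(s - t) / (\<gamma> - t) \<le> (s - \<alpha>) / (\<gamma> - \<alpha>)"
      proof -
        have "(s - \<alpha>) * (\<gamma> - t) - (s - t) * (\<gamma> - \<alpha>) = (t - \<alpha>) * (\<gamma> - s)"
          by (simp add: algebra_simps)
        moreover have "(t - \<alpha>) * (\<gamma> - s) \<ge> 0" using * order by simp
        ultimately show ?thesis using * order by (simp add: field_simps)
      qed
    qed (use g_pos[OF sV] in simp)
    also have "\<dots> = g s - g s * ((\<gamma> - s) / (\<gamma> - \<alpha>))"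
      using order by (simp add: field_simps)
    finally show ?thesis using \<kappa>(2) by (simp add: algebra_simps)
  qed
  have "\<exists>c>0. (\<forall>t\<in>V. t \<notin> T \<longrightarrow> (g t - c) * poly W t > 0)"
  proof -
    from T show ?thesis
    proof
      assume T: "T = {\<alpha><..<\<beta>}"
      define c where "c = Inf (g ` {\<gamma><..<1})"
      have sub: "t \<in> V" if "\<gamma> < t" "t < 1" for t using that order by (auto simp: V_def)
      have ne: "g ` {\<gamma><..<1} \<noteq> {}" using order by simp
      have ge: "g s \<le> c" if "s \<in> V" "s < \<gamma>" for s
        unfolding c_def by (rule cInf_greatest[OF ne]) (use that sub g_mono[of s] in force)
      have bdd: "bdd_below (g ` {\<gamma><..<1})"
        using g_pos sub by (intro bdd_belowI[of _ 0]) (auto intro: less_imp_le)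
      have le: "c \<le> g t" if "\<gamma> < t" "t < 1" for t
        unfolding c_def by (rule cInf_lower[OF _ bdd]) (use that in auto)
      have lt: "g s < c" if s: "s \<in> V" "s < \<gamma>" for s
      proof -
        obtain s' where "max s \<beta> < s'" "s' < \<gamma>" using s order dense[of "max s \<beta>" \<gamma>] by auto
        then have "s' \<in> V" using order by (auto simp: V_def)
        then show ?thesis
          using g_mono[of s s'] ge[of s'] s \<open>max s \<beta> < s'\<close> \<open>s' < \<gamma>\<close> by auto
      qed
      have gt: "c < g t" if t: "\<gamma> < t" "t < 1" for t
      proof -
        obtain t' where "\<gamma> < t'" "t' < t" using t dense by blast
        then show ?thesis using g_mono[of t' t] le[of t'] t sub by auto
      qed
      have "(\<beta> + \<gamma>) / 2 \<in> V" using order by (auto simp: V_def field_simps)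
      then have "c > 0" using g_pos[of "(\<beta> + \<gamma>) / 2"] lt[of "(\<beta> + \<gamma>) / 2"] order
        by (auto simp: field_simps)
      moreover have "(g t - c) * poly W t > 0" if t: "t \<in> V" "t \<notin> T" for t
      proof (cases "t < \<gamma>")
        case True
        have "(t - \<alpha>) * (t - \<beta>) > 0"
          using t T order by (auto simp: V_def zero_less_mult_iff)
        then have "poly W t < 0" using True by (simp add: W mult_pos_neg)
        then show ?thesis using lt[of t] t True by (simp add: mult_neg_neg)
      next
        case False
        then have "t > \<gamma>" "t < 1" using t by (auto simp: V_def)
        then show ?thesis using gt[of t] order by (simp add: W)
      qed
      ultimately show ?thesis by blast
    next
      assume T: "T = {\<beta><..<\<gamma>}"
      define S where "S = {t \<in> V. \<alpha> < t}"
      define c where "c = Inf (g ` S)"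
      define s where "s = (\<alpha> + \<beta>) / 2"
      define e where "e = g s * ((\<gamma> - s) / (\<gamma> - \<alpha>))"
      have s: "\<alpha> < s" "s < \<beta>" using order by (auto simp: s_def)
      have sS: "s \<in> S" using s order by (auto simp: V_def S_def)
      have "(\<gamma> - s) / (\<gamma> - \<alpha>) \<le> 1" using s order by simp
      then have e_le: "e \<le> g s"
        unfolding e_def using g_pos[of s] sS by (intro mult_left_le) (auto simp: S_def)
      have "e > 0" using g_pos[of s] sS s order by (simp add: e_def S_def)
      have lower: "e \<le> g t" if "t \<in> S" for t
      proof (cases "t < s")
        case True
        then show ?thesis using g_lower[of t s] that s by (simp add: e_def S_def)
      next
        case False
        then show ?thesis using g_mono[of s t] e_le that sS by (cases "s = t") (auto simp: S_def)
      qed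
      have ne: "g ` S \<noteq> {}" using sS by blast
      have "e \<le> c" unfolding c_def by (rule cInf_greatest[OF ne]) (use lower in auto)
      have le: "c \<le> g t" if "t \<in> S" for t
        unfolding c_def by (rule cInf_lower) (use that lower in \<open>auto intro!: bdd_belowI[of _ e]\<close>)
      have between: "\<exists>t'\<in>S. t' < t" if t: "\<alpha> < t" for t
      proof -
        obtain t' where "\<alpha> < t'" "t' < min t \<beta>" using t order dense[of \<alpha> "min t \<beta>"] by auto
        then show ?thesis using order by (intro bexI[of _ t']) (auto simp: S_def V_def)
      qed
      have gt: "c < g t" if t: "t \<in> S" for t
        using between[of t] t le g_mono[of _ t] by (force simp: S_def)
      have lt: "g t < c" if t: "t \<in> V" "t < \<alpha>" for t
      proof -
        have "t < (t + \<alpha>) / 2" "(t + \<alpha>) / 2 \<in> V" "(t + \<alpha>) / 2 < \<alpha>"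
          using t order by (auto simp: V_def field_simps)
        moreover have "g ((t + \<alpha>) / 2) \<le> c"
          unfolding c_def
          by (rule cInf_greatest[OF ne]) (use g_mono calculation in \<open>force simp: S_def\<close>)
        ultimately show ?thesis using g_mono[of t "(t + \<alpha>) / 2"] t by simp
      qed
      have "(g t - c) * poly W t > 0" if t: "t \<in> V" "t \<notin> T" for t
      proof -
        have pos: "(t - \<beta>) * (t - \<gamma>) > 0"
          using t T order by (auto simp: V_def zero_less_mult_iff)
        show ?thesis
        proof (cases "t < \<alpha>")
          case True
          then have "poly W t < 0" using pos by (simp add: W mult.assoc mult_neg_pos)
          then show ?thesis using lt[of t] t True by (simp add: mult_neg_neg)
        next
          case False
          then have "t \<in> S" using t by (auto simp: V_def S_def)
          then show ?thesis using gt[of t] pos by (simp add: W S_def mult.assoc)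
        qed
      qed
      then show ?thesis using \<open>e > 0\<close> \<open>e \<le> c\<close> by (intro exI[of _ c]) auto
    qed
  qed
  then obtain c where c: "c > 0" "\<And>t. t \<in> V \<Longrightarrow> t \<notin> T \<Longrightarrow> (g t - c) * poly W t > 0" by blast
  show thesis
  proof (rule that[OF d1_pos d2_pos c(1)])
    show "poly (L + smult c W) t = h \<alpha> + d1 * (t - \<alpha>) + d2 * (t - \<alpha>) * (t - \<beta>)
        + c * (t - \<alpha>) * (t - \<beta>) * (t - \<gamma>)" for t
      by (simp add: L_def W algebra_simps)
    show "poly (L + smult c W) t = h t" if "t \<in> {\<alpha>, \<beta>, \<gamma>}" for t
      using L W0 that by simp
    show "poly (L + smult c W) t < h t"
      if "-1 \<le> t" "t < 1" "t \<notin> T" "t \<notin> {\<alpha>, \<beta>, \<gamma>}" for t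
      using g[of t] c(2)[of t] that by (simp add: V_def algebra_simps)
  qed
qed

subsection \<open>Moments of the sphere measure\<close>

lemma prod_Basis_vec: "(\<Prod>b\<in>Basis. (v :: real^'n) \<bullet> b) = (\<Prod>i\<in>UNIV. v $ i)"
proof -
  have "(Basis :: (real^'n) set) = range (\<lambda>i. axis i 1)"
    by (auto simp: Basis_vec_def)
  moreover have "inj (\<lambda>i :: 'n. axis i (1::real))"
    by (auto intro: injI simp: axis_eq_axis)
  ultimately have "(\<Prod>b\<in>Basis. v \<bullet> b) = (\<Prod>i\<in>UNIV. v \<bullet> axis i 1)"
    using prod.reindex[of "\<lambda>i :: 'n. axis i (1::real)" UNIV "\<lambda>b. v \<bullet> b"] by (simp add: o_def)
  then show ?thesis by (simp add: inner_axis)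
qed

definition signed_permutation :: "('n \<Rightarrow> real) \<Rightarrow> ('n \<Rightarrow> 'n) \<Rightarrow> real^'n \<Rightarrow> real^'n" where
  "signed_permutation s \<pi> x = (\<chi> i. s i * x $ \<pi> i)"

lemma signed_permutation_nth [simp]: "signed_permutation s \<pi> x $ i = s i * x $ \<pi> i"
  by (simp add: signed_permutation_def)

lemma measurable_signed_permutation [measurable]:
  "signed_permutation s \<pi> \<in> borel_measurable borel"
  unfolding signed_permutation_def
  by (intro borel_measurable_continuous_onI continuous_intros)

lemma norm_signed_permutation:
  assumes "bij \<pi>" "\<And>i. \<bar>s i\<bar> = 1"
  shows "norm (signed_permutation s \<pi> x) = norm x"
proof -
  have "(s i * y)\<^sup>2 = y\<^sup>2" for i y
    using assms(2)[of i] by (simp add: power_mult_distrib abs_square_eq_1)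
  then have "(\<Sum>i\<in>UNIV. (signed_permutation s \<pi> x $ i)\<^sup>2) = (\<Sum>i\<in>UNIV. (x $ \<pi> i)\<^sup>2)"
    by simp
  also have "\<dots> = (\<Sum>i\<in>UNIV. (x $ i)\<^sup>2)"
    using assms(1) by (rule sum.reindex_bij_betw)
  finally show ?thesis by (simp add: norm_vec_def L2_set_def)
qed

lemma distr_lborel_signed_permutation:
  assumes \<pi>: "bij \<pi>" and s: "\<And>i. \<bar>s i\<bar> = 1"
  shows "distr lborel borel (signed_permutation s \<pi>) = (lborel :: (real^'n) measure)"
proof (rule lborel_eqI[symmetric])
  fix l u :: "real^'n"
  assume le_Basis: "\<And>b. b \<in> Basis \<Longrightarrow> l \<bullet> b \<le> u \<bullet> b"
  have le: "l $ i \<le> u $ i" for i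
    using le_Basis[of "axis i 1"] by (simp add: inner_axis axis_in_Basis_iff)
  have s': "s i = 1 \<or> s i = -1" for i using s[of i] by (auto simp: abs_if split: if_splits)
  define l' :: "real^'n" where "l' = (\<chi> j. let i = inv \<pi> j in if s i = 1 then l $ i else - u $ i)"
  define u' :: "real^'n" where "u' = (\<chi> j. let i = inv \<pi> j in if s i = 1 then u $ i else - l $ i)"
  have inv: "inv \<pi> (\<pi> i) = i" for i using \<pi> by (simp add: bij_is_inj)
  have l': "l' $ \<pi> i = (if s i = 1 then l $ i else - u $ i)"
    and u': "u' $ \<pi> i = (if s i = 1 then u $ i else - l $ i)" for i
    by (simp_all add: l'_def u'_def inv)
  have "signed_permutation s \<pi> x \<in> box l u \<longleftrightarrow> x \<in> box l' u'" for x
  proof -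
    have "x \<in> box l' u' \<longleftrightarrow> (\<forall>i. l' $ \<pi> i < x $ \<pi> i \<and> x $ \<pi> i < u' $ \<pi> i)"
      using \<pi> by (simp add: mem_box_cart) (metis bij_inv_eq_iff)
    also have "\<dots> \<longleftrightarrow> (\<forall>i. l $ i < s i * x $ \<pi> i \<and> s i * x $ \<pi> i < u $ i)"
    proof (rule iff_allI)
      fix i show "(l' $ \<pi> i < x $ \<pi> i \<and> x $ \<pi> i < u' $ \<pi> i) =
          (l $ i < s i * x $ \<pi> i \<and> s i * x $ \<pi> i < u $ i)"
        using s'[of i] by (auto simp: l' u')
    qed
    finally show ?thesis by (simp add: mem_box_cart)
  qed
  then have "signed_permutation s \<pi> -` box l u = box l' u'" by auto
  then have "emeasure (distr lborel borel (signed_permutation s \<pi>)) (box l u)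
      = emeasure lborel (box l' u')"
    by (simp add: emeasure_distr)
  also have "\<dots> = (\<Prod>b\<in>Basis. (u' - l') \<bullet> b)"
  proof (rule emeasure_lborel_box)
    fix b :: "real^'n" assume "b \<in> Basis"
    then obtain j where "b = axis j 1" by (auto simp: Basis_vec_def)
    moreover have "l' $ j \<le> u' $ j" using le by (simp add: l'_def u'_def Let_def)
    ultimately show "l' \<bullet> b \<le> u' \<bullet> b" by (simp add: inner_axis)
  qed
  also have "(\<Prod>b\<in>Basis. (u' - l') \<bullet> b) = (\<Prod>j\<in>UNIV. (u' - l') $ j)"
    by (rule prod_Basis_vec)
  also have "\<dots> = (\<Prod>i\<in>UNIV. (u' - l') $ \<pi> i)"
    using \<pi> by (rule prod.reindex_bij_betw[symmetric])
  also have "\<dots> = (\<Prod>i\<in>UNIV. (u - l) $ i)"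
    by (rule prod.cong) (simp_all add: l' u')
  also have "\<dots> = (\<Prod>b\<in>Basis. (u - l) \<bullet> b)"
    by (rule prod_Basis_vec[symmetric])
  finally show "emeasure (distr lborel borel (signed_permutation s \<pi>)) (box l u)
      = (\<Prod>b\<in>Basis. (u - l) \<bullet> b)" .
qed simp

lemma distr_sphere_measure_signed_permutation:
  assumes \<pi>: "bij \<pi>" and s: "\<And>i. \<bar>s i\<bar> = 1"
  shows "distr sphere_measure borel (signed_permutation s \<pi>) = (sphere_measure :: (real^'n) measure)"
proof -
  let ?f = "signed_permutation s \<pi> :: real^'n \<Rightarrow> real^'n"
  let ?U = "uniform_measure lborel (cball 0 1) :: (real^'n) measure"
  have [measurable]: "sgn \<in> borel_measurable (borel :: (real^'n) measure)"
    unfolding sgn_div_norm by measurable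
  have f_cball: "?f -` cball 0 1 = cball 0 1"
    using norm_signed_permutation[OF assms] by (auto simp: dist_norm)
  have U: "distr ?U borel ?f = ?U"
  proof (rule measure_eqI)
    fix A :: "(real^'n) set" assume "A \<in> sets (distr ?U borel ?f)"
    then have [measurable]: "A \<in> sets borel" by simp
    have [measurable]: "?f -` A \<in> sets borel"
      using measurable_sets_borel[OF measurable_signed_permutation, of A] by simp
    have "emeasure (distr ?U borel ?f) A = emeasure ?U (?f -` A)"
      by (simp add: emeasure_distr)
    also have "\<dots> = emeasure lborel (?f -` (cball 0 1 \<inter> A)) / emeasure lborel (cball 0 1 :: (real^'n) set)"
      by (subst emeasure_uniform_measure) (simp_all add: f_cball)
    also have "emeasure lborel (?f -` (cball 0 1 \<inter> A)) = emeasure (distr lborel borel ?f) (cball 0 1 \<inter> A)"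
      by (simp add: emeasure_distr)
    also have "\<dots> = emeasure lborel (cball 0 1 \<inter> A)"
      by (simp add: distr_lborel_signed_permutation assms)
    finally show "emeasure (distr ?U borel ?f) A = emeasure ?U A"
      by (simp add: emeasure_uniform_measure)
  qed simp
  have comm: "?f (sgn x) = sgn (?f x)" for x
    using norm_signed_permutation[where x = x, OF assms] by (simp add: sgn_div_norm vec_eq_iff)
  have "distr sphere_measure borel ?f = distr ?U borel (?f \<circ> sgn)"
    unfolding sphere_measure_def by (rule distr_distr) simp_all
  also have "?f \<circ> sgn = sgn \<circ> ?f" using comm by auto
  also have "distr ?U borel (sgn \<circ> ?f) = distr (distr ?U borel ?f) borel sgn"
    by (rule distr_distr[symmetric]) simp_all
  finally show ?thesis by (simp add: U sphere_measure_def)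
qed

lemma finite_exponents: "finite {a :: 'n::finite \<Rightarrow> nat. (\<Sum>i\<in>UNIV. a i) \<le> d}"
proof (rule finite_subset)
  have "a i \<le> d" if "(\<Sum>i\<in>UNIV. a i) \<le> d" for a :: "'n \<Rightarrow> nat" and i
    using that member_le_sum[of i UNIV a] by simp
  then show "{a. (\<Sum>i\<in>UNIV. a i) \<le> d} \<subseteq>
      {a :: 'n \<Rightarrow> nat. \<forall>i. (i \<in> UNIV \<longrightarrow> a i \<in> {..d}) \<and> (i \<notin> UNIV \<longrightarrow> a i = 0)}"
    by auto
qed (intro finite_set_of_finite_funs; simp)

lemma monomial_in_polynomials_upto:
  fixes a :: "'n::finite \<Rightarrow> nat"
  assumes "(\<Sum>i\<in>UNIV. a i) \<le> d"
  shows "(\<lambda>x. \<Prod>i\<in>UNIV. (x $ i) ^ a i) \<in> polynomials_upto d"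
proof -
  have "(\<Prod>i\<in>UNIV. (x $ i) ^ a i) = (\<Sum>b\<in>{a :: 'n \<Rightarrow> nat. (\<Sum>i\<in>UNIV. a i) \<le> d}.
      of_bool (b = a) * (\<Prod>i\<in>UNIV. (x $ i) ^ b i))" for x :: "real^'n"
    using assms finite_exponents[of d, where ?'n = 'n] by (simp add: of_bool_def if_distrib[of "\<lambda>c. c * _"] sum.delta cong: if_cong)
  then show ?thesis
    unfolding polynomials_upto_def by (intro CollectI exI[of _ "\<lambda>b. of_bool (b = a)"] ext)
qed

lemma sum_of_bool_eq [simp]: "(\<Sum>l\<in>UNIV. of_bool (l = (i::'n::finite))) = (1::nat)"
  by (simp add: of_bool_def sum.delta)

lemma prod_power_of_bool [simp]: "(\<Prod>l\<in>UNIV. x l ^ of_bool (l = (i::'n::finite))) = (x i :: real)"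
proof -
  have "(\<Prod>l\<in>UNIV. x l ^ of_bool (l = i)) = (\<Prod>l\<in>UNIV. if l = i then x l else 1)"
    by (rule prod.cong) auto
  then show ?thesis by simp
qed

lemma coordinate_monomials_in_polynomials_upto:
  shows "(\<lambda>x :: real^'n. 1) \<in> polynomials_upto 3" "(\<lambda>x :: real^'n. x $ i) \<in> polynomials_upto 3"
    and "(\<lambda>x :: real^'n. x $ i * x $ j) \<in> polynomials_upto 3"
    and "(\<lambda>x :: real^'n. x $ i * x $ j * x $ k) \<in> polynomials_upto 3"
  using monomial_in_polynomials_upto[of "\<lambda>l :: 'n. 0" 3]
    monomial_in_polynomials_upto[of "\<lambda>l. of_bool (l = i)" 3]
    monomial_in_polynomials_upto[of "\<lambda>l. of_bool (l = i) + of_bool (l = j)" 3]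
    monomial_in_polynomials_upto[of "\<lambda>l. of_bool (l = i) + of_bool (l = j) + of_bool (l = k)" 3]
  by (simp_all add: sum.distrib power_add prod.distrib)

lemma borel_measurable_polynomials_upto:
  assumes "p \<in> polynomials_upto d"
  shows "p \<in> borel_measurable (borel :: (real^'n) measure)"
proof -
  have "continuous_on UNIV p"
    using assms unfolding polynomials_upto_def by (auto intro!: continuous_intros)
  then show ?thesis by (rule borel_measurable_continuous_onI)
qed

lemma monomial_cases:
  fixes a :: "'n::finite \<Rightarrow> nat"
  assumes "(\<Sum>i\<in>UNIV. a i) \<le> 3"
  obtains "\<And>x :: real^'n. (\<Prod>i\<in>UNIV. (x $ i) ^ a i) = 1"
  | i where "\<And>x :: real^'n. (\<Prod>i\<in>UNIV. (x $ i) ^ a i) = x $ i"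
  | i j where "\<And>x :: real^'n. (\<Prod>i\<in>UNIV. (x $ i) ^ a i) = x $ i * x $ j"
  | i j k where "\<And>x :: real^'n. (\<Prod>i\<in>UNIV. (x $ i) ^ a i) = x $ i * x $ j * x $ k"
proof -
  have split: "\<exists>i b. (\<Sum>l\<in>UNIV. b l) = m \<and>
      (\<forall>x :: real^'n. (\<Prod>l\<in>UNIV. (x $ l) ^ a l) = x $ i * (\<Prod>l\<in>UNIV. (x $ l) ^ b l))"
    if a: "(\<Sum>l\<in>UNIV. a l) = Suc m" for a :: "'n \<Rightarrow> nat" and m
  proof -
    obtain i where i: "a i > 0" using a by (metis gr0I sum.neutral nat.distinct(1))
    define b where "b l = a l - of_bool (l = i)" for l
    have ab: "a = (\<lambda>l. of_bool (l = i) + b l)" using i by (auto simp: b_def)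
    show ?thesis
      using a unfolding ab by (intro exI[of _ i] exI[of _ b]) (simp add: sum.distrib power_add prod.distrib)
  qed
  have zero: "(\<Prod>l\<in>UNIV. (x $ l) ^ b l) = 1" if "(\<Sum>l\<in>UNIV. b l) = 0"
    for b :: "'n \<Rightarrow> nat" and x :: "real^'n" using that by simp
  consider "(\<Sum>i\<in>UNIV. a i) = 0" | "(\<Sum>i\<in>UNIV. a i) = Suc 0" | "(\<Sum>i\<in>UNIV. a i) = Suc (Suc 0)"
    | "(\<Sum>i\<in>UNIV. a i) = Suc (Suc (Suc 0))"
    using assms by linarith
  then show thesis
  proof cases
    case 1
    then show thesis using zero that(1) by blast
  next
    case 2
    from split[OF 2] obtain i b where "(\<Sum>l\<in>UNIV. b l) = 0"
      "\<forall>x :: real^'n. (\<Prod>l\<in>UNIV. (x $ l) ^ a l) = x $ i * (\<Prod>l\<in>UNIV. (x $ l) ^ b l)" by blast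
    then show thesis using that(2)[of i] zero[of b] by simp
  next
    case 3
    from split[OF 3] obtain i b where b: "(\<Sum>l\<in>UNIV. b l) = Suc 0"
      "\<forall>x :: real^'n. (\<Prod>l\<in>UNIV. (x $ l) ^ a l) = x $ i * (\<Prod>l\<in>UNIV. (x $ l) ^ b l)" by blast
    from split[OF b(1)] obtain j c where "(\<Sum>l\<in>UNIV. c l) = 0"
      "\<forall>x :: real^'n. (\<Prod>l\<in>UNIV. (x $ l) ^ b l) = x $ j * (\<Prod>l\<in>UNIV. (x $ l) ^ c l)" by blast
    then show thesis using that(3)[of i j] b(2) zero[of c] by simp
  next
    case 4
    from split[OF 4] obtain i b where b: "(\<Sum>l\<in>UNIV. b l) = Suc (Suc 0)"
      "\<forall>x :: real^'n. (\<Prod>l\<in>UNIV. (x $ l) ^ a l) = x $ i * (\<Prod>l\<in>UNIV. (x $ l) ^ b l)" by blast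
    from split[OF b(1)] obtain j c where c: "(\<Sum>l\<in>UNIV. c l) = Suc 0"
      "\<forall>x :: real^'n. (\<Prod>l\<in>UNIV. (x $ l) ^ b l) = x $ j * (\<Prod>l\<in>UNIV. (x $ l) ^ c l)" by blast
    from split[OF c(1)] obtain k d where "(\<Sum>l\<in>UNIV. d l) = 0"
      "\<forall>x :: real^'n. (\<Prod>l\<in>UNIV. (x $ l) ^ c l) = x $ k * (\<Prod>l\<in>UNIV. (x $ l) ^ d l)" by blast
    then show thesis using that(4)[of i j k] b(2) c(2) zero[of d] by (simp add: mult.assoc)
  qed
qed

definition balanced_moments :: "(real^'n) set \<Rightarrow> bool" where
  "balanced_moments C \<longleftrightarrow> (\<forall>i. (\<Sum>x\<in>C. x $ i) = 0) \<and>
     (\<forall>i j. (\<Sum>x\<in>C. x $ i * x $ j) = (if i = j then real (card C) / real CARD('n) else 0)) \<and>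
     (\<forall>i j k. (\<Sum>x\<in>C. x $ i * x $ j * x $ k) = 0)"

lemma spherical_design_balanced_moments:
  fixes B :: "(real^'n) set"
  assumes B: "spherical_design 3 B" and "B \<noteq> {}"
  shows "balanced_moments B"
proof -
  have code: "finite B" "B \<subseteq> sphere 0 1"
    using B by (auto simp: spherical_design_def spherical_code_def)
  then have N: "real (card B) > 0" using \<open>B \<noteq> {}\<close> by (simp add: card_gt_0_iff)
  have avg: "(\<Sum>x\<in>B. p x) = real (card B) * (\<integral>x. p x \<partial>sphere_measure)"
    if "p \<in> polynomials_upto 3" for p
    using B that N by (auto simp: spherical_design_def field_simps)
  have inv: "(\<Sum>x\<in>B. p (signed_permutation s \<pi> x)) = (\<Sum>x\<in>B. p x)"
    if "bij \<pi>" "\<And>i. \<bar>s i\<bar> = 1" "p \<in> polynomials_upto 3"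
      "(\<lambda>x. p (signed_permutation s \<pi> x)) \<in> polynomials_upto 3" for s \<pi> p
  proof -
    have "(\<integral>x. p x \<partial>sphere_measure) = (\<integral>x. p x \<partial>distr sphere_measure borel (signed_permutation s \<pi>))"
      using that by (simp add: distr_sphere_measure_signed_permutation)
    also have "\<dots> = (\<integral>x. p (signed_permutation s \<pi> x) \<partial>sphere_measure)"
      using borel_measurable_polynomials_upto[OF that(3)]
      by (intro integral_distr) (auto simp: sphere_measure_def)
    finally show ?thesis using that by (simp add: avg)
  qed
  note mem = coordinate_monomials_in_polynomials_upto
  have neg_mem: "(\<lambda>x. - p x) \<in> polynomials_upto 3" if p: "p \<in> polynomials_upto 3" for p :: "real^'n \<Rightarrow> real"
  proof -
    obtain c where p: "p = (\<lambda>x. \<Sum>a\<in>{a :: 'n \<Rightarrow> nat. (\<Sum>i\<in>UNIV. a i) \<le> 3}.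
        c a * (\<Prod>i\<in>UNIV. (x $ i) ^ a i))"
      using p unfolding polynomials_upto_def by blast
    show ?thesis
      unfolding polynomials_upto_def p mem_Collect_eq
      by (rule exI[of _ "\<lambda>a. - c a"]) (simp add: sum_negf)
  qed
  have odd: "(\<Sum>x\<in>B. p x) = 0"
    if "p \<in> polynomials_upto 3" "bij \<pi>" "\<And>i. \<bar>s i\<bar> = 1" "\<And>x. p (signed_permutation s \<pi> x) = - p x"
    for p s \<pi>
    using inv[of \<pi> s p] that neg_mem[of p] by (simp add: sum_negf)
  have m1: "(\<Sum>x\<in>B. x $ i) = 0" for i
    by (rule odd[of _ id "\<lambda>_. -1"]) (auto intro: mem)
  have m3: "(\<Sum>x\<in>B. x $ i * x $ j * x $ k) = 0" for i j k
    by (rule odd[of _ id "\<lambda>_. -1"]) (auto intro: mem)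
  have m2: "(\<Sum>x\<in>B. x $ i * x $ j) = 0" if "i \<noteq> j" for i j
    by (rule odd[of _ id "\<lambda>l. if l = i then -1 else 1"]) (use that in \<open>auto intro: mem\<close>)
  have diag: "(\<Sum>x\<in>B. x $ i * x $ i) = (\<Sum>x\<in>B. x $ j * x $ j)" for i j
    using inv[of "Transposition.transpose i j" "\<lambda>_. 1" "\<lambda>x. x $ i * x $ i"]
    by (simp add: mem)
  have "(\<Sum>j\<in>UNIV. \<Sum>x\<in>B. x $ j * x $ j) = (\<Sum>x\<in>B. \<Sum>j\<in>UNIV. x $ j * x $ j)"
    by (rule sum.swap)
  also have "\<dots> = (\<Sum>x\<in>B. x \<bullet> x)" by (simp add: inner_vec_def)
  also have "\<dots> = (\<Sum>x\<in>B. 1)"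
    by (rule sum.cong) (use code in \<open>auto simp: norm_eq_1\<close>)
  finally have tr: "(\<Sum>j\<in>UNIV. \<Sum>x\<in>B. x $ j * x $ j) = real (card B)" by simp
  have "real CARD('n) * (\<Sum>x\<in>B. x $ i * x $ i) = real (card B)" for i
  proof -
    have "(\<Sum>j\<in>UNIV. \<Sum>x\<in>B. x $ j * x $ j) = (\<Sum>j\<in>(UNIV :: 'n set). \<Sum>x\<in>B. x $ i * x $ i)"
      by (rule sum.cong[OF refl]) (rule diag)
    then show ?thesis using tr by simp
  qed
  then have "(\<Sum>x\<in>B. x $ i * x $ i) = real (card B) / real CARD('n)" for i
    by (simp add: field_simps)
  then show ?thesis using m1 m2 m3 by (simp add: balanced_moments_def)
qed

lemma balanced_moments_spherical_design:
  fixes B C :: "(real^'n) set"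
  assumes B: "spherical_design 3 B" and C: "spherical_code C" "balanced_moments C"
    and card: "card C = card B" and "B \<noteq> {}"
  shows "spherical_design 3 C"
proof -
  note bal = spherical_design_balanced_moments[OF B \<open>B \<noteq> {}\<close>] C(2)
  have mono: "(\<Sum>x\<in>C. \<Prod>i\<in>UNIV. (x $ i) ^ a i) = (\<Sum>x\<in>B. \<Prod>i\<in>UNIV. (x $ i) ^ a i)"
    if "(\<Sum>i\<in>UNIV. a i) \<le> 3" for a :: "'n \<Rightarrow> nat"
    using that by (cases rule: monomial_cases)
      (use bal card in \<open>simp_all add: balanced_moments_def\<close>)
  have "(\<Sum>x\<in>C. p x) = (\<Sum>x\<in>B. p x)" if p: "p \<in> polynomials_upto 3" for p
  proof -
    obtain c where p: "p = (\<lambda>x. \<Sum>a\<in>{a :: 'n \<Rightarrow> nat. (\<Sum>i\<in>UNIV. a i) \<le> 3}.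
        c a * (\<Prod>i\<in>UNIV. (x $ i) ^ a i))"
      using p unfolding polynomials_upto_def by blast
    have "(\<Sum>x\<in>D. p x) = (\<Sum>a\<in>{a :: 'n \<Rightarrow> nat. (\<Sum>i\<in>UNIV. a i) \<le> 3}.
        c a * (\<Sum>x\<in>D. \<Prod>i\<in>UNIV. (x $ i) ^ a i))" for D
      unfolding p by (subst sum.swap) (simp add: sum_distrib_left)
    then show ?thesis using mono by simp
  qed
  then show ?thesis using B C(1) card by (auto simp: spherical_design_def)
qed

subsection \<open>Harmonic tensors and the linear programming bound\<close>

lemma sum_sum_eq_sum_squares:
  fixes \<phi> :: "'b \<Rightarrow> 'a \<Rightarrow> real"
  assumes "\<And>x y. x \<in> C \<Longrightarrow> y \<in> C \<Longrightarrow> K x y = (\<Sum>p\<in>I. \<phi> p x * \<phi> p y)"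
  shows "(\<Sum>x\<in>C. \<Sum>y\<in>C. K x y) = (\<Sum>p\<in>I. (\<Sum>x\<in>C. \<phi> p x)\<^sup>2)"
proof -
  have "(\<Sum>x\<in>C. \<Sum>y\<in>C. K x y) = (\<Sum>x\<in>C. \<Sum>y\<in>C. \<Sum>p\<in>I. \<phi> p x * \<phi> p y)"
    using assms by (intro sum.cong) auto
  also have "\<dots> = (\<Sum>x\<in>C. \<Sum>p\<in>I. \<Sum>y\<in>C. \<phi> p x * \<phi> p y)"
    by (intro sum.cong[OF refl] sum.swap)
  also have "\<dots> = (\<Sum>p\<in>I. \<Sum>x\<in>C. \<Sum>y\<in>C. \<phi> p x * \<phi> p y)"
    by (rule sum.swap)
  finally show ?thesis by (simp add: power2_eq_square sum_product)
qed

lemma sum_delta_contract: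
  fixes Z :: "'n::finite \<Rightarrow> 'n \<Rightarrow> 'n \<Rightarrow> real"
  shows "(\<Sum>i\<in>UNIV. \<Sum>j\<in>UNIV. \<Sum>k\<in>UNIV. Z i j k *
            (of_bool (i = j) * y k + of_bool (i = k) * y j + of_bool (j = k) * y i))
    = (\<Sum>i\<in>UNIV. \<Sum>j\<in>UNIV. Z i i j * y j + Z i j i * y j + Z i j j * y i)"
proof -
  have "(\<Sum>j\<in>UNIV. \<Sum>k\<in>UNIV. Z i j k * (of_bool (i = j) * y k))
      = (\<Sum>j\<in>UNIV. if i = j then \<Sum>k\<in>UNIV. Z i j k * y k else 0)" for i
    by (intro sum.cong) auto
  then have 1: "(\<Sum>j\<in>UNIV. \<Sum>k\<in>UNIV. Z i j k * (of_bool (i = j) * y k))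
      = (\<Sum>k\<in>UNIV. Z i i k * y k)" for i
    by simp
  have "(\<Sum>k\<in>UNIV. Z i j k * (of_bool (i' = k) * y'))
      = (\<Sum>k\<in>UNIV. if i' = k then Z i j k * y' else 0)" for i j i' y'
    by (intro sum.cong) auto
  then have 2: "(\<Sum>k\<in>UNIV. Z i j k * (of_bool (i' = k) * y')) = Z i j i' * y'" for i j i' y'
    by simp
  show ?thesis by (simp add: distrib_left sum.distrib 1 2)
qed

lemma sum_UNIV_triple:
  fixes g :: "'a::finite \<times> 'b::finite \<times> 'c::finite \<Rightarrow> real"
  shows "(\<Sum>p\<in>UNIV. g p) = (\<Sum>i\<in>UNIV. \<Sum>j\<in>UNIV. \<Sum>k\<in>UNIV. g (i, j, k))"
  by (simp add: sum.cartesian_product split_def flip: UNIV_Times_UNIV)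

text \<open>The trace-free parts of the tensors \<open>x \<otimes> x\<close> and \<open>x \<otimes> x \<otimes> x\<close> of a unit vector.\<close>

definition harmonic2 :: "'n \<times> 'n \<Rightarrow> real^'n \<Rightarrow> real" where
  "harmonic2 = (\<lambda>(i, j) x. x $ i * x $ j - of_bool (i = j) / real CARD('n))"

definition harmonic3 :: "'n \<times> 'n \<times> 'n \<Rightarrow> real^'n \<Rightarrow> real" where
  "harmonic3 = (\<lambda>(i, j, k) x. x $ i * x $ j * x $ k -
     (of_bool (i = j) * x $ k + of_bool (i = k) * x $ j + of_bool (j = k) * x $ i) / (real CARD('n) + 2))"

lemma unit_sum_squares: "norm (x :: real^'n) = 1 \<Longrightarrow> (\<Sum>i\<in>UNIV. x $ i * x $ i) = 1"
  by (simp add: norm_eq_1 inner_vec_def)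

lemma sum_harmonic2:
  fixes x y :: "real^'n"
  assumes "norm x = 1" "norm y = 1"
  shows "(\<Sum>p\<in>UNIV. harmonic2 p x * harmonic2 p y) = (x \<bullet> y)\<^sup>2 - 1 / real CARD('n)"
proof -
  define n where "n = real CARD('n)"
  have n: "n > 0" by (simp add: n_def)
  have "(\<Sum>p\<in>UNIV. harmonic2 p x * harmonic2 p y)
      = (\<Sum>i\<in>UNIV. \<Sum>j\<in>UNIV. (x $ i * x $ j - of_bool (i = j) / n) * (y $ i * y $ j - of_bool (i = j) / n))"
    by (simp add: harmonic2_def n_def sum.cartesian_product split_def flip: UNIV_Times_UNIV)
  also have "\<dots> = (\<Sum>i\<in>UNIV. \<Sum>j\<in>UNIV. (x $ i * y $ i) * (x $ j * y $ j)
      + (if i = j then 1 / n\<^sup>2 - (x $ i * x $ i) / n - (y $ i * y $ i) / n else 0))"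
    by (intro sum.cong) (auto simp: algebra_simps power2_eq_square)
  also have "\<dots> = (x \<bullet> y)\<^sup>2 + (\<Sum>i\<in>UNIV. 1 / n\<^sup>2 - (x $ i * x $ i) / n - (y $ i * y $ i) / n)"
    by (simp add: sum.distrib inner_vec_def power2_eq_square sum_product)
  also have "(\<Sum>i\<in>UNIV. 1 / n\<^sup>2 - (x $ i * x $ i) / n - (y $ i * y $ i) / n) = - 1 / n"
    using n unit_sum_squares[OF assms(1)] unit_sum_squares[OF assms(2)]
    by (simp add: sum_subtractf flip: sum_divide_distrib n_def) (simp add: power2_eq_square field_simps)
  finally show ?thesis by (simp add: n_def)
qed

lemma sum_harmonic3:
  fixes x y :: "real^'n"
  assumes "norm x = 1" "norm y = 1"
  shows "(\<Sum>p\<in>UNIV. harmonic3 p x * harmonic3 p y) = (x \<bullet> y)^3 - 3 * (x \<bullet> y) / (real CARD('n) + 2)"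
proof -
  define r where "r = 1 / (real CARD('n) + 2)"
  have r: "r * (real CARD('n) + 2) = 1" by (simp add: r_def)
  define M where "M v i j k = v $ i * v $ j * v $ k" for v :: "real^'n" and i j k
  define D where "D v i j k = of_bool (i = j) * v $ k + of_bool (i = k) * v $ j + of_bool (j = k) * v $ i"
    for v :: "real^'n" and i j k
  define S where "S f = (\<Sum>i\<in>UNIV. \<Sum>j\<in>UNIV. \<Sum>k\<in>UNIV. f i j k)" for f :: "'n \<Rightarrow> 'n \<Rightarrow> 'n \<Rightarrow> real"
  have S_add: "S (\<lambda>i j k. f i j k + g i j k) = S f + S g" for f g by (simp add: S_def sum.distrib)
  have S_cmult: "S (\<lambda>i j k. c * f i j k) = c * S f" for f c by (simp add: S_def sum_distrib_left)
  have MD: "S (\<lambda>i j k. M v i j k * D w i j k) = 3 * (v \<bullet> w)" if "norm v = 1" for v w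
  proof -
    have "S (\<lambda>i j k. M v i j k * D w i j k) = (\<Sum>i\<in>UNIV. \<Sum>j\<in>UNIV.
        2 * ((v $ i * v $ i) * (v $ j * w $ j)) + (v $ i * w $ i) * (v $ j * v $ j))"
      unfolding S_def D_def sum_delta_contract by (simp add: M_def algebra_simps)
    also have "\<dots> = 2 * ((\<Sum>i\<in>UNIV. v $ i * v $ i) * (v \<bullet> w)) + (v \<bullet> w) * (\<Sum>i\<in>UNIV. v $ i * v $ i)"
      by (simp add: sum.distrib sum_product inner_vec_def flip: sum_distrib_left)
    finally show ?thesis using unit_sum_squares[OF that] by simp
  qed
  have "(\<Sum>p\<in>UNIV. harmonic3 p x * harmonic3 p y) =
      S (\<lambda>i j k. (M x i j k - r * D x i j k) * (M y i j k - r * D y i j k))"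
    unfolding sum_UNIV_triple S_def by (simp add: harmonic3_def M_def D_def r_def)
  also have "\<dots> = S (\<lambda>i j k. M x i j k * M y i j k + (-r) * (M x i j k * D y i j k)
      + (-r) * (M y i j k * D x i j k) + r\<^sup>2 * (D x i j k * D y i j k))"
    by (simp add: algebra_simps power2_eq_square)
  also have "\<dots> = S (\<lambda>i j k. M x i j k * M y i j k) - r * S (\<lambda>i j k. M x i j k * D y i j k)
      - r * S (\<lambda>i j k. M y i j k * D x i j k) + r\<^sup>2 * S (\<lambda>i j k. D x i j k * D y i j k)"
    unfolding S_add S_cmult by simp
  also have "S (\<lambda>i j k. M x i j k * M y i j k) = (x \<bullet> y)^3"
  proof -
    have "(x \<bullet> y)^3 = (x \<bullet> y) * ((x \<bullet> y) * (x \<bullet> y))" by (simp add: power3_eq_cube)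
    also have "\<dots> = S (\<lambda>i j k. (x $ i * y $ i) * ((x $ j * y $ j) * (x $ k * y $ k)))"
      by (simp add: S_def inner_vec_def sum_product) (simp add: sum_distrib_left)
    finally show ?thesis by (simp add: M_def ac_simps)
  qed
  also have "S (\<lambda>i j k. M x i j k * D y i j k) = 3 * (x \<bullet> y)" by (rule MD[OF assms(1)])
  also have "S (\<lambda>i j k. M y i j k * D x i j k) = 3 * (y \<bullet> x)" by (rule MD[OF assms(2)])
  also have "S (\<lambda>i j k. D x i j k * D y i j k) = 3 * (real CARD('n) + 2) * (x \<bullet> y)"
  proof -
    have "S (\<lambda>i j k. D x i j k * D y i j k) = (\<Sum>i\<in>UNIV. \<Sum>j\<in>UNIV.
        2 * (x $ j * y $ j) + x $ i * y $ i + (if i = j then 6 * (x $ i * y $ i) else 0))"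
      unfolding S_def D_def[of y] sum_delta_contract
      by (intro sum.cong) (auto simp: D_def algebra_simps)
    also have "\<dots> = 3 * (real CARD('n) + 2) * (x \<bullet> y)"
      by (simp add: sum.distrib inner_vec_def flip: sum_distrib_left) (simp add: algebra_simps)
    finally show ?thesis .
  qed
  also have "r\<^sup>2 * (3 * (real CARD('n) + 2) * (x \<bullet> y)) = r * (r * (real CARD('n) + 2)) * (3 * (x \<bullet> y))"
    by (simp add: power2_eq_square)
  finally show ?thesis using r by (simp add: inner_commute r_def algebra_simps) 
qed

lemma balanced_moments_iff_harmonic_sums:
  fixes C :: "(real^'n) set"
  shows "balanced_moments C \<longleftrightarrow> (\<forall>i. (\<Sum>x\<in>C. x $ i) = 0) \<and>
    (\<forall>p. (\<Sum>x\<in>C. harmonic2 p x) = 0) \<and> (\<forall>p. (\<Sum>x\<in>C. harmonic3 p x) = 0)"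
proof -
  have 2: "(\<Sum>x\<in>C. harmonic2 (i, j) x) =
      (\<Sum>x\<in>C. x $ i * x $ j) - (if i = j then real (card C) / real CARD('n) else 0)" for i j
    by (simp add: harmonic2_def sum_subtractf)
  have 3: "(\<Sum>x\<in>C. harmonic3 (i, j, k) x) = (\<Sum>x\<in>C. x $ i * x $ j * x $ k)"
    if "\<And>i. (\<Sum>x\<in>C. x $ i) = 0" for i j k
    using that
    by (simp add: harmonic3_def sum_subtractf sum.distrib flip: sum_divide_distrib sum_distrib_left)
  show ?thesis
    unfolding balanced_moments_def split_paired_All 2 using 3 by auto
qed

lemma energy_harmonic_expansion:
  fixes C :: "(real^'n) set" and f :: "real \<Rightarrow> real"
  assumes C: "spherical_code C"
    and f: "\<And>t. f t = f\<^sub>0 + f\<^sub>1 * t + f\<^sub>2 * (t\<^sup>2 - 1 / real CARD('n)) + f\<^sub>3 * (t^3 - 3 * t / (real CARD('n) + 2))"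
  shows "energy f C = f\<^sub>0 * (real (card C))\<^sup>2 - real (card C) * f 1
    + f\<^sub>1 * (\<Sum>i\<in>UNIV. (\<Sum>x\<in>C. x $ i)\<^sup>2)
    + f\<^sub>2 * (\<Sum>p\<in>UNIV. (\<Sum>x\<in>C. harmonic2 p x)\<^sup>2)
    + f\<^sub>3 * (\<Sum>p\<in>UNIV. (\<Sum>x\<in>C. harmonic3 p x)\<^sup>2)"
proof -
  have fin: "finite C" using C by (simp add: spherical_code_def)
  have unit: "norm x = 1" if "x \<in> C" for x
    using C that by (auto simp: spherical_code_def)
  have "(\<Sum>y\<in>C - {x}. f (x \<bullet> y)) = (\<Sum>y\<in>C. f (x \<bullet> y)) - f 1" if "x \<in> C" for x
    using fin that unit[OF that] by (simp add: sum_diff1 norm_eq_1)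
  then have "energy f C = (\<Sum>x\<in>C. \<Sum>y\<in>C. f (x \<bullet> y)) - real (card C) * f 1"
    by (simp add: energy_def sum_subtractf)
  also have "(\<Sum>x\<in>C. \<Sum>y\<in>C. f (x \<bullet> y)) = f\<^sub>0 * (real (card C))\<^sup>2
      + f\<^sub>1 * (\<Sum>x\<in>C. \<Sum>y\<in>C. x \<bullet> y)
      + f\<^sub>2 * (\<Sum>x\<in>C. \<Sum>y\<in>C. (x \<bullet> y)\<^sup>2 - 1 / real CARD('n))
      + f\<^sub>3 * (\<Sum>x\<in>C. \<Sum>y\<in>C. (x \<bullet> y)^3 - 3 * (x \<bullet> y) / (real CARD('n) + 2))"
    unfolding f sum.distrib sum_distrib_left by (simp add: power2_eq_square)
  also have "(\<Sum>x\<in>C. \<Sum>y\<in>C. x \<bullet> y) = (\<Sum>i\<in>UNIV. (\<Sum>x\<in>C. x $ i)\<^sup>2)"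
    by (rule sum_sum_eq_sum_squares) (simp add: inner_vec_def)
  also have "(\<Sum>x\<in>C. \<Sum>y\<in>C. (x \<bullet> y)\<^sup>2 - 1 / real CARD('n)) = (\<Sum>p\<in>UNIV. (\<Sum>x\<in>C. harmonic2 p x)\<^sup>2)"
    by (rule sum_sum_eq_sum_squares) (simp add: sum_harmonic2 unit)
  also have "(\<Sum>x\<in>C. \<Sum>y\<in>C. (x \<bullet> y)^3 - 3 * (x \<bullet> y) / (real CARD('n) + 2))
      = (\<Sum>p\<in>UNIV. (\<Sum>x\<in>C. harmonic3 p x)\<^sup>2)"
    by (rule sum_sum_eq_sum_squares) (simp add: sum_harmonic3 unit)
  finally show ?thesis by simp
qed

lemma energy_linear_programming_bound:
  fixes C :: "(real^'n) set" and f :: "real \<Rightarrow> real"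
  assumes C: "spherical_code C"
    and f: "\<And>t. f t = f\<^sub>0 + f\<^sub>1 * t + f\<^sub>2 * (t\<^sup>2 - 1 / real CARD('n)) + f\<^sub>3 * (t^3 - 3 * t / (real CARD('n) + 2))"
    and pos: "f\<^sub>1 > 0" "f\<^sub>2 > 0" "f\<^sub>3 > 0"
  shows "energy f C \<ge> f\<^sub>0 * (real (card C))\<^sup>2 - real (card C) * f 1"
    and "energy f C = f\<^sub>0 * (real (card C))\<^sup>2 - real (card C) * f 1 \<longleftrightarrow> balanced_moments C"
proof -
  define s1 where "s1 = (\<Sum>i\<in>UNIV. (\<Sum>x\<in>C. x $ i)\<^sup>2)"
  define s2 where "s2 = (\<Sum>p\<in>UNIV. (\<Sum>x\<in>C. harmonic2 p x)\<^sup>2)"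
  define s3 where "s3 = (\<Sum>p\<in>UNIV. (\<Sum>x\<in>C. harmonic3 p x)\<^sup>2)"
  have E: "energy f C = f\<^sub>0 * (real (card C))\<^sup>2 - real (card C) * f 1 + f\<^sub>1 * s1 + f\<^sub>2 * s2 + f\<^sub>3 * s3"
    unfolding s1_def s2_def s3_def by (rule energy_harmonic_expansion[OF C f])
  have "s1 \<ge> 0" "s2 \<ge> 0" "s3 \<ge> 0" by (auto simp: s1_def s2_def s3_def sum_nonneg)
  then have nn: "f\<^sub>1 * s1 \<ge> 0" "f\<^sub>2 * s2 \<ge> 0" "f\<^sub>3 * s3 \<ge> 0" using pos by auto
  show "energy f C \<ge> f\<^sub>0 * (real (card C))\<^sup>2 - real (card C) * f 1" using E nn by linarith
  have "balanced_moments C \<longleftrightarrow> s1 = 0 \<and> s2 = 0 \<and> s3 = 0"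
    unfolding balanced_moments_iff_harmonic_sums s1_def s2_def s3_def
    by (simp add: sum_nonneg_eq_0_iff)
  also have "\<dots> \<longleftrightarrow> f\<^sub>1 * s1 + f\<^sub>2 * s2 + f\<^sub>3 * s3 = 0"
    using nn pos by (auto simp: add_nonneg_eq_0_iff)
  finally show "energy f C = f\<^sub>0 * (real (card C))\<^sup>2 - real (card C) * f 1 \<longleftrightarrow> balanced_moments C"
    using E by linarith
qed

subsection \<open>Distance distributions and the energy bound\<close>

lemma inner_unit_bounds:
  fixes x y :: "'a::real_inner"
  assumes "norm x = 1" "norm y = 1" "x \<noteq> y"
  shows "-1 \<le> x \<bullet> y" "x \<bullet> y < 1"
proof -
  show "-1 \<le> x \<bullet> y" using Cauchy_Schwarz_ineq2[of x y] assms by simp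
  have "x \<bullet> y \<noteq> 1"
  proof
    assume "x \<bullet> y = 1"
    then have "(norm (x - y))\<^sup>2 = 0"
      using assms by (simp add: power2_norm_eq_inner inner_diff norm_eq_1 inner_commute)
    then show False using assms by simp
  qed
  then show "x \<bullet> y < 1" using norm_cauchy_schwarz[of x y] assms by simp
qed

lemma energy_strict_minorant:
  assumes C: "spherical_code C" "avoiding T C"
    and eq: "\<And>t. t \<in> S \<Longrightarrow> f t = h t"
    and less: "\<And>t. -1 \<le> t \<Longrightarrow> t < 1 \<Longrightarrow> t \<notin> T \<Longrightarrow> t \<notin> S \<Longrightarrow> f t < h t"
  shows "energy f C \<le> energy h C"
    and "energy f C = energy h C \<Longrightarrow> inner_products C \<subseteq> S"
proof -
  have fin: "finite C" using C by (simp add: spherical_code_def)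
  have le: "f (x \<bullet> y) \<le> h (x \<bullet> y) \<and> (x \<bullet> y \<notin> S \<longrightarrow> f (x \<bullet> y) < h (x \<bullet> y))"
    if "x \<in> C" "y \<in> C - {x}" for x y
  proof -
    have "x \<bullet> y \<in> inner_products C" using that by (auto simp: inner_products_def)
    then have "x \<bullet> y \<notin> T" using C by (auto simp: avoiding_def)
    moreover have "norm x = 1" "norm y = 1" "x \<noteq> y"
      using that C by (auto simp: spherical_code_def)
    ultimately show ?thesis
      using inner_unit_bounds[of x y] eq[of "x \<bullet> y"] less[of "x \<bullet> y"] by (cases "x \<bullet> y \<in> S") auto
  qed
  have inner_le: "(\<Sum>y\<in>C - {x}. f (x \<bullet> y)) \<le> (\<Sum>y\<in>C - {x}. h (x \<bullet> y))" if "x \<in> C" for x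
    using le that by (intro sum_mono) auto
  then show "energy f C \<le> energy h C" unfolding energy_def by (rule sum_mono)
  show "inner_products C \<subseteq> S" if "energy f C = energy h C"
  proof (rule ccontr)
    assume "\<not> inner_products C \<subseteq> S"
    then obtain x y where xy: "x \<in> C" "y \<in> C - {x}" "x \<bullet> y \<notin> S"
      by (auto simp: inner_products_def)
    have "(\<Sum>y\<in>C - {x}. f (x \<bullet> y)) < (\<Sum>y\<in>C - {x}. h (x \<bullet> y))"
      by (rule sum_strict_mono_ex1) (use fin le xy in auto)
    then have "energy f C < energy h C"
      unfolding energy_def
      by (intro sum_strict_mono_ex1) (use fin inner_le xy in auto)
    with that show False by simp
  qed
qed

text \<open>Summing \<open>(x \<bullet> y - u) (x \<bullet> y - v)\<close> over the code isolates the multiplicity of \<open>t\<close>,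
  and the moments of order at most two determine the sum.\<close>

lemma card_inner_eq:
  fixes C :: "(real^'n) set"
  assumes C: "spherical_code C" "balanced_moments C" and x: "x \<in> C"
    and I: "inner_products C \<subseteq> {t, u, v}" and t: "t \<noteq> u" "t \<noteq> v" "t < 1"
  shows "real (card {y\<in>C. x \<bullet> y = t}) =
    (real (card C) * (1 / real CARD('n) + u * v) - (1 - u) * (1 - v)) / ((t - u) * (t - v))"
proof -
  define N where "N = real (card C)"
  define n where "n = real CARD('n)"
  have fin: "finite C" using C by (simp add: spherical_code_def)
  have nx: "norm x = 1" using C x by (auto simp: spherical_code_def)
  have "(\<Sum>y\<in>C. x \<bullet> y) = (\<Sum>i\<in>UNIV. \<Sum>y\<in>C. x $ i * y $ i)"
    unfolding inner_vec_def by (subst sum.swap) simp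
  also have "\<dots> = 0"
    using C(2) by (simp add: balanced_moments_def flip: sum_distrib_left)
  finally have m1: "(\<Sum>y\<in>C. x \<bullet> y) = 0" .
  have "(\<Sum>y\<in>C. (x \<bullet> y)\<^sup>2) = (\<Sum>y\<in>C. \<Sum>i\<in>UNIV. \<Sum>j\<in>UNIV. (x $ i * x $ j) * (y $ i * y $ j))"
    by (simp add: inner_vec_def power2_eq_square sum_product ac_simps)
  also have "\<dots> = (\<Sum>i\<in>UNIV. \<Sum>y\<in>C. \<Sum>j\<in>UNIV. (x $ i * x $ j) * (y $ i * y $ j))"
    by (rule sum.swap)
  also have "\<dots> = (\<Sum>i\<in>UNIV. \<Sum>j\<in>UNIV. \<Sum>y\<in>C. (x $ i * x $ j) * (y $ i * y $ j))"
    by (intro sum.cong[OF refl] sum.swap)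
  also have "\<dots> = (\<Sum>i\<in>UNIV. \<Sum>j\<in>UNIV. if i = j then (x $ i * x $ i) * (N / n) else 0)"
    using C(2) by (intro sum.cong) (auto simp: balanced_moments_def N_def n_def simp flip: sum_distrib_left)
  also have "\<dots> = N / n"
    using unit_sum_squares[OF nx] by (simp flip: sum_divide_distrib sum_distrib_right)
  finally have m2: "(\<Sum>y\<in>C. (x \<bullet> y)\<^sup>2) = N / n" .
  have xx: "x \<bullet> x = 1" using nx by (simp add: norm_eq_1)
  have sub: "{y\<in>C. x \<bullet> y = t} \<subseteq> C - {x}" using xx t by auto
  have "(\<Sum>y\<in>C. (x \<bullet> y - u) * (x \<bullet> y - v))
      = (\<Sum>y\<in>C. (x \<bullet> y)\<^sup>2) - (u + v) * (\<Sum>y\<in>C. x \<bullet> y) + (\<Sum>y\<in>C. u * v)"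
    unfolding sum_distrib_left sum_subtractf[symmetric] sum.distrib[symmetric]
    by (intro sum.cong) (auto simp: algebra_simps power2_eq_square)
  then have "(\<Sum>y\<in>C. (x \<bullet> y - u) * (x \<bullet> y - v)) = N * (1 / n + u * v)"
    by (simp add: m1 m2 algebra_simps flip: N_def)
  also have "(\<Sum>y\<in>C. (x \<bullet> y - u) * (x \<bullet> y - v))
      = (1 - u) * (1 - v) + (\<Sum>y\<in>C - {x}. (x \<bullet> y - u) * (x \<bullet> y - v))"
    using fin x xx by (simp add: sum.remove)
  also have "(\<Sum>y\<in>C - {x}. (x \<bullet> y - u) * (x \<bullet> y - v))
      = (\<Sum>y\<in>{y\<in>C. x \<bullet> y = t}. (x \<bullet> y - u) * (x \<bullet> y - v))"
  proof (rule sum.mono_neutral_right)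
    show "\<forall>y\<in>C - {x} - {y \<in> C. x \<bullet> y = t}. (x \<bullet> y - u) * (x \<bullet> y - v) = 0"
      using I x by (auto simp: inner_products_def)
  qed (use fin sub in auto)
  also have "\<dots> = real (card {y\<in>C. x \<bullet> y = t}) * ((t - u) * (t - v))" by simp
  finally have "real (card {y\<in>C. x \<bullet> y = t}) * ((t - u) * (t - v)) = N * (1 / n + u * v) - (1 - u) * (1 - v)"
    by linarith
  moreover have "(t - u) * (t - v) \<noteq> 0" using t by simp
  ultimately show ?thesis by (simp add: nonzero_eq_divide_eq flip: N_def n_def)
qed

lemma sum_inner_products:
  assumes C: "spherical_code C" "x \<in> C" and S: "inner_products C \<subseteq> S" "finite S" "1 \<notin> S"
  shows "(\<Sum>y\<in>C - {x}. g (x \<bullet> y)) = (\<Sum>t\<in>S. real (card {y\<in>C. x \<bullet> y = t}) * g t)"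
proof -
  have xx: "x \<bullet> x = 1" using C by (auto simp: spherical_code_def norm_eq_1)
  have "(\<Sum>y\<in>C - {x}. g (x \<bullet> y)) = (\<Sum>t\<in>S. \<Sum>y\<in>{y \<in> C - {x}. x \<bullet> y = t}. g (x \<bullet> y))"
    using C S by (intro sum.group[symmetric]) (auto simp: spherical_code_def inner_products_def)
  also have "\<dots> = (\<Sum>t\<in>S. \<Sum>y\<in>{y \<in> C. x \<bullet> y = t}. g (x \<bullet> y))"
    using S xx by (intro sum.cong) auto
  finally show ?thesis by simp
qed

theorem theorem7p6:
  fixes h :: "real \<Rightarrow> real" and \<alpha> \<beta> \<gamma> :: real and T :: "real set"
    and B :: "(real^'n) set" and m\<^sub>\<alpha> m\<^sub>\<beta> m\<^sub>\<gamma> :: nat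
  assumes "potential h" and "absolutely_monotone h"
    and "\<forall>t\<in>{-1<..<1}. (deriv ^^ 4) h t > 0"
    and "-1 \<le> \<alpha>" and "\<alpha> \<le> \<beta>" and "\<beta> \<le> \<gamma>" and "\<gamma> < 1"
    and "three_code \<alpha> \<beta> \<gamma> B" and "spherical_design 3 B"
    and "\<alpha> * \<beta> + \<beta> * \<gamma> + \<gamma> * \<alpha> \<ge> - (3 / (real CARD('n) + 2))"
    and "\<alpha> + \<beta> + \<gamma> \<le> 0"
    and "T = {\<alpha><..<\<beta>} \<or> T = {\<beta><..<\<gamma>}"
    and "distance_distribution B = [m\<^sub>\<alpha>, m\<^sub>\<beta>, m\<^sub>\<gamma>]"
  shows "distance_invariant B \<and>
    (\<exists>D \<in> (avoiding_codes (card B) T :: (real^'n) set set).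
       energy h D = min_energy TYPE('n) h (card B) T) \<and>
    min_energy TYPE('n) h (card B) T
      = real (card B) * (real m\<^sub>\<alpha> * h \<alpha> + real m\<^sub>\<beta> * h \<beta> + real m\<^sub>\<gamma> * h \<gamma>) \<and>
    (\<forall>C :: (real^'n) set. spherical_code C \<and> avoiding T C \<and> card C = card B \<longrightarrow>
       energy h C \<ge> min_energy TYPE('n) h (card B) T \<and>
       (energy h C = min_energy TYPE('n) h (card B) T \<longrightarrow>
          spherical_design 3 C \<and> inner_products C = {\<alpha>, \<beta>, \<gamma>} \<and>
          distance_invariant C \<and> distance_distribution C = [m\<^sub>\<alpha>, m\<^sub>\<beta>, m\<^sub>\<gamma>]))"
proof -
  define n where "n = real CARD('n)"
  have n: "n > 0" by (simp add: n_def)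
  have B: "spherical_code B" "inner_products B = {\<alpha>, \<beta>, \<gamma>}"
    and order: "\<alpha> < \<beta>" "\<beta> < \<gamma>"
    using assms(5,6,8) by (auto simp: three_code_def)
  have ne: "B \<noteq> {}" using B(2) by (auto simp: inner_products_def)
  have card_pos: "card B > 0" using B(1) ne by (simp add: spherical_code_def card_gt_0_iff)
  have bal: "balanced_moments B" by (rule spherical_design_balanced_moments[OF assms(9) ne])
  have avB: "avoiding T B" using B(2) order assms(12) by (auto simp: avoiding_def)

  obtain d\<^sub>1 d\<^sub>2 d\<^sub>3 :: real and f :: "real \<Rightarrow> real"
    where d: "d\<^sub>1 > 0" "d\<^sub>2 > 0" "d\<^sub>3 > 0"
      and f: "\<And>t. f t = h \<alpha> + d\<^sub>1 * (t - \<alpha>) + d\<^sub>2 * (t - \<alpha>) * (t - \<beta>) + d\<^sub>3 * (t - \<alpha>) * (t - \<beta>) * (t - \<gamma>)"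
      and f_eq: "\<And>t. t \<in> {\<alpha>, \<beta>, \<gamma>} \<Longrightarrow> f t = h t"
      and f_less: "\<And>t. -1 \<le> t \<Longrightarrow> t < 1 \<Longrightarrow> t \<notin> T \<Longrightarrow> t \<notin> {\<alpha>, \<beta>, \<gamma>} \<Longrightarrow> f t < h t"
    using cubic_minorant[OF assms(1-4) order assms(7,12)] by metis
  define f\<^sub>2 where "f\<^sub>2 = d\<^sub>2 - d\<^sub>3 * (\<alpha> + \<beta> + \<gamma>)"
  define f\<^sub>1 where "f\<^sub>1 = d\<^sub>1 - d\<^sub>2 * (\<alpha> + \<beta>) + d\<^sub>3 * (\<alpha> * \<beta> + \<beta> * \<gamma> + \<gamma> * \<alpha> + 3 / (n + 2))"
  define f\<^sub>0 where "f\<^sub>0 = h \<alpha> - d\<^sub>1 * \<alpha> + d\<^sub>2 * \<alpha> * \<beta> - d\<^sub>3 * \<alpha> * \<beta> * \<gamma> + f\<^sub>2 / n"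
  have f_harmonic: "f t = f\<^sub>0 + f\<^sub>1 * t + f\<^sub>2 * (t\<^sup>2 - 1 / n) + d\<^sub>3 * (t^3 - 3 * t / (n + 2))" for t
    unfolding f f\<^sub>0_def f\<^sub>1_def f\<^sub>2_def
    by (simp add: algebra_simps power2_eq_square power3_eq_cube diff_divide_distrib add_divide_distrib)
  have "d\<^sub>3 * (\<alpha> + \<beta> + \<gamma>) \<le> 0" using d assms(11) by (simp add: mult_nonneg_nonpos)
  then have f2_pos: "f\<^sub>2 > 0" using d by (simp add: f\<^sub>2_def)
  have "\<alpha> + \<beta> \<le> 0" using order assms(11) by linarith
  then have "d\<^sub>2 * (\<alpha> + \<beta>) \<le> 0" using d by (simp add: mult_nonneg_nonpos)
  moreover have "d\<^sub>3 * (\<alpha> * \<beta> + \<beta> * \<gamma> + \<gamma> * \<alpha> + 3 / (n + 2)) \<ge> 0"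
    using d assms(10) by (simp add: n_def)
  ultimately have f1_pos: "f\<^sub>1 > 0" using d unfolding f\<^sub>1_def by linarith
  define E where "E = f\<^sub>0 * (real (card B))\<^sup>2 - real (card B) * f 1"
  note bound = energy_linear_programming_bound[OF _ f_harmonic[unfolded n_def] f1_pos f2_pos d(3)]

  note minorant = energy_strict_minorant[where f = f and h = h and T = T and S = "{\<alpha>, \<beta>, \<gamma>}", OF _ _ f_eq f_less]
  have EB: "energy h B = E"
  proof -
    have "h (x \<bullet> y) = f (x \<bullet> y)" if "x \<in> B" "y \<in> B - {x}" for x y
    proof -
      have "x \<bullet> y \<in> inner_products B" using that unfolding inner_products_def by blast
      then show ?thesis using f_eq B(2) by simp
    qed
    then have "energy h B = energy f B" unfolding energy_def by (intro sum.cong refl)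
    then show ?thesis using bound(2)[OF B(1)] bal by (simp add: E_def)
  qed
  have lower: "energy h C \<ge> E" if "spherical_code C" "avoiding T C" "card C = card B"
    for C :: "(real^'n) set"
    using minorant(1)[OF that(1,2)] bound(1)[OF that(1)] that(3)
    by (simp add: E_def)
  have min: "min_energy TYPE('n) h (card B) T = E"
    unfolding min_energy_def
    by (rule Least_equality) (use B avB EB lower in \<open>auto simp: avoiding_codes_def\<close>)

  define N where "N = real (card B)"
  define A where "A t u v = (N * (1 / n + u * v) - (1 - u) * (1 - v)) / ((t - u) * (t - v))" for t u v
  have counts: "real (card {y\<in>C. x \<bullet> y = \<alpha>}) = A \<alpha> \<beta> \<gamma>"
    "real (card {y\<in>C. x \<bullet> y = \<beta>}) = A \<beta> \<alpha> \<gamma>"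
    "real (card {y\<in>C. x \<bullet> y = \<gamma>}) = A \<gamma> \<alpha> \<beta>"
    if "spherical_code C" "balanced_moments C" "inner_products C \<subseteq> {\<alpha>, \<beta>, \<gamma>}" "card C = card B" "x \<in> C"
    for C :: "(real^'n) set" and x
    unfolding A_def N_def n_def that(4)[symmetric]
    by (rule card_inner_eq[OF that(1,2,5)]; use that(3) order assms(7) in auto)+
  have same: "card {y\<in>C. x \<bullet> y = t} = distance_mult B t"
    if C: "spherical_code C" "balanced_moments C" "inner_products C \<subseteq> {\<alpha>, \<beta>, \<gamma>}" "card C = card B"
      and "x \<in> C" "t \<in> {\<alpha>, \<beta>, \<gamma>}"
    for C :: "(real^'n) set" and x t
  proof -
    have eq: "card {y\<in>C. x \<bullet> y = t} = card {y\<in>B. z \<bullet> y = t}" if "z \<in> B" for z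
    proof -
      have "inner_products B \<subseteq> {\<alpha>, \<beta>, \<gamma>}" using B(2) by simp
      from counts[OF B(1) bal this refl that] counts[OF C \<open>x \<in> C\<close>]
      have "real (card {y\<in>C. x \<bullet> y = t}) = real (card {y\<in>B. z \<bullet> y = t})"
        using \<open>t \<in> _\<close> by (elim insertE) simp_all
      then show ?thesis by (simp only: of_nat_eq_iff)
    qed
    show ?thesis
      unfolding distance_mult_def
      by (rule the_equality[symmetric]) (use eq ne in auto)
  qed
  have sameB: "card {y\<in>B. x \<bullet> y = t} = distance_mult B t" if "x \<in> B" "t \<in> {\<alpha>, \<beta>, \<gamma>}" for x t
    using same[OF B(1) bal _ refl that] B(2) by simp
  have invariant: "distance_invariant C"
    if C: "spherical_code C" "balanced_moments C" "inner_products C \<subseteq> {\<alpha>, \<beta>, \<gamma>}" "card C = card B"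
    for C :: "(real^'n) set"
    using same[OF C] C(3) unfolding distance_invariant_def by blast
  have sorted: "sorted_list_of_set {\<alpha>, \<beta>, \<gamma>} = [\<alpha>, \<beta>, \<gamma>]"
    using sorted_list_of_set.idem_if_sorted_distinct[of "[\<alpha>, \<beta>, \<gamma>]"] order by simp
  have m: "distance_mult B \<alpha> = m\<^sub>\<alpha>" "distance_mult B \<beta> = m\<^sub>\<beta>" "distance_mult B \<gamma> = m\<^sub>\<gamma>"
    using assms(13) by (simp_all add: distance_distribution_def B(2) sorted)
  have "energy h B = (\<Sum>x\<in>B. \<Sum>t\<in>{\<alpha>, \<beta>, \<gamma>}. real (card {y\<in>B. x \<bullet> y = t}) * h t)"
    unfolding energy_def
    by (intro sum.cong refl sum_inner_products) (use B order assms(7) in auto)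
  also have "\<dots> = (\<Sum>x\<in>B. \<Sum>t\<in>{\<alpha>, \<beta>, \<gamma>}. real (distance_mult B t) * h t)"
    by (intro sum.cong refl) (simp add: sameB)
  also have "\<dots> = real (card B) * (real m\<^sub>\<alpha> * h \<alpha> + real m\<^sub>\<beta> * h \<beta> + real m\<^sub>\<gamma> * h \<gamma>)"
    using order by (simp add: m)
  finally have E_eq: "E = real (card B) * (real m\<^sub>\<alpha> * h \<alpha> + real m\<^sub>\<beta> * h \<beta> + real m\<^sub>\<gamma> * h \<gamma>)"
    using EB by simp

  have rigid: "spherical_design 3 C \<and> inner_products C = {\<alpha>, \<beta>, \<gamma>} \<and>
      distance_invariant C \<and> distance_distribution C = [m\<^sub>\<alpha>, m\<^sub>\<beta>, m\<^sub>\<gamma>]"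
    if C: "spherical_code C" "avoiding T C" "card C = card B" and "energy h C = E"
    for C :: "(real^'n) set"
  proof -
    have fh: "energy f C \<le> energy h C" by (rule minorant(1)[OF C(1,2)])
    have Ef: "energy f C \<ge> E" using bound(1)[OF C(1)] C(3) by (simp add: E_def)
    have I: "inner_products C \<subseteq> {\<alpha>, \<beta>, \<gamma>}"
      by (rule minorant(2)[OF C(1,2)]) (use fh Ef that(4) in auto)
    have balC: "balanced_moments C"
      using bound(2)[OF C(1)] C(3) fh Ef that(4) by (simp add: E_def)
    note same = same[OF C(1) balC I C(3)]
    obtain x where x: "x \<in> C" using card_pos C(3) by fastforce
    have "t \<in> inner_products C" if t: "t \<in> {\<alpha>, \<beta>, \<gamma>}" for t
    proof -
      obtain z w where zw: "z \<in> B" "w \<in> B" "t = z \<bullet> w"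
        using t B(2) unfolding inner_products_def by blast
      then have "card {y\<in>B. z \<bullet> y = t} > 0"
        using B(1) by (auto simp: card_gt_0_iff spherical_code_def)
      then have "card {y\<in>C. x \<bullet> y = t} > 0"
        using same[OF x t] sameB[OF zw(1) t] by simp
      then obtain y where "y \<in> C" "x \<bullet> y = t" by (force simp: card_gt_0_iff)
      moreover have "x \<noteq> y"
        using calculation t order assms(7) x C(1) by (auto simp: spherical_code_def norm_eq_1)
      ultimately show ?thesis using x by (auto simp: inner_products_def)
    qed
    then have I_eq: "inner_products C = {\<alpha>, \<beta>, \<gamma>}" using I by blast
    have "distance_mult C t = distance_mult B t" if t: "t \<in> {\<alpha>, \<beta>, \<gamma>}" for t
      unfolding distance_mult_def[of C] by (rule the_equality) (use same t x in auto)
    then have "distance_distribution C = [m\<^sub>\<alpha>, m\<^sub>\<beta>, m\<^sub>\<gamma>]"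
      by (simp add: distance_distribution_def I_eq sorted m)
    then show ?thesis
      using balanced_moments_spherical_design[OF assms(9) C(1) balC C(3) ne] I_eq
        invariant[OF C(1) balC I C(3)] by blast
  qed
  show ?thesis
    unfolding min
    using invariant[OF B(1) bal _ refl] B avB EB E_eq lower rigid
    by (auto simp: avoiding_codes_def)
qed

end
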